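(* Let $X$ and $Y$ be finite sets with $|X|=|Y|=m$, and let $\Gamma_1=\{A_1,\dots,A_n\}$ and $\Gamma_2=\{B_1,\dots,B_n\}$ be arbitrary graphs on $X$ and $Y$ respectively (with the same number $n$ of edges). Let $\mathcal{M}_{\Gamma_1,\Gamma_2}$ be the canonical transformation from $\Gamma_1$ to $\Gamma_2$, an $n\times n$ matrix over the ring of isopartials $\Pi(X,Y)$. Then, as subsets of the set $S_{X,Y}$ of all bijections $X\to Y$, $$Iso(\Gamma_1,\Gamma_2)=\det(\mathcal{M}_{\Gamma_1,\Gamma_2}).$$
   Context: A graph on a finite set is a set of 2-element subsets (edges) of it. $Iso(\Gamma_1,\Gamma_2)$ is the set of bijections $f:X\to Y$ that carry the edges of $\Gamma_1$ exactly onto the edges of $\Gamma_2$. An isopartial is an injective function from a subset of $X$ to $Y$. The ring of isopartials $\Pi(X,Y)$ is the power set of $S_{X,Y}$, with addition the symmetric difference and multiplication the intersection (zero $\emptyset$, unit $S_{X,Y}$). An isopartial $\pi$ is identified with the element $[\pi]=\{f\in S_{X,Y}: f \text{ restricts to }\pi\text{ on the domain of }\pi\}$ of $\Pi(X,Y)$. Write $A_i=\{a_i^1,a_i^2\}$ and $B_j=\{b_j^1,b_j^2\}$. The canonical transformation $\mathcal{M}_{\Gamma_1,\Gamma_2}$ is the $n\times n$ matrix with $(i,j)$ entry $$\begin{pmatrix} A_i \\ {B_j} \end{pmatrix}=\begin{pmatrix} a_i^1&a_i^2 \\ {b_j^1}&b_j^2 \end{pmatrix}+\begin{pmatrix} a_i^1&a_i^2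 \\ {b_j^2}&b_j^1 \end{pmatrix},$$ where a two-row array denotes the isopartial sending each upper entry to the entry below it. For an $n\times n$ matrix $(c_{i,j})$ over $\Pi(X,Y)$, $\det((c_{i,j}))=\sum_{\rho\in \mathcal{S}_n}\prod_{i=1}^n c_{i,\rho(i)}$, with sum and product those of $\Pi(X,Y)$ (no signs, since $1=-1$; the empty determinant is the unit). *)

theory Defs
  imports Main "HOL-Library.FuncSet" "HOL-Combinatorics.Permutations" "HOL-Algebra.Ring"
begin

definition graph_on :: "'a set \<Rightarrow> 'a set set \<Rightarrow> bool" where
  "graph_on X \<Gamma> \<longleftrightarrow> (\<forall>e\<in>\<Gamma>. e \<subseteq> X \<and> card e = 2)"

text \<open>Bijections from \<open>X\<close> to \<open>Y\<close> are taken in \<open>X \<rightarrow>\<^sub>E Y\<close>, so that two of them are equal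
  as HOL functions iff they agree on \<open>X\<close>.\<close>

definition bijections :: "'a set \<Rightarrow> 'b set \<Rightarrow> ('a \<Rightarrow> 'b) set" where
  "bijections X Y = {f \<in> X \<rightarrow>\<^sub>E Y. bij_betw f X Y}"

definition graph_isos ::
    "'a set \<Rightarrow> 'b set \<Rightarrow> 'a set set \<Rightarrow> 'b set set \<Rightarrow> ('a \<Rightarrow> 'b) set" where
  "graph_isos X Y \<Gamma>1 \<Gamma>2 = {f \<in> bijections X Y. (\<lambda>e. f ` e) ` \<Gamma>1 = \<Gamma>2}"

definition isopartials :: "'a set \<Rightarrow> 'b set \<Rightarrow> ('a \<rightharpoonup> 'b) set" where
  "isopartials X Y = {\<pi>. dom \<pi> \<subseteq> X \<and> ran \<pi> \<subseteq> Y \<and> inj_on \<pi> (dom \<pi>)}"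

definition isopartial_ring :: "'a set \<Rightarrow> 'b set \<Rightarrow> ('a \<Rightarrow> 'b) set ring" where
  "isopartial_ring X Y =
     \<lparr>carrier = Pow (bijections X Y), mult = (\<inter>), one = bijections X Y,
      zero = {}, add = (\<lambda>P Q. (P - Q) \<union> (Q - P))\<rparr>"

definition isopartial_elem :: "'a set \<Rightarrow> 'b set \<Rightarrow> ('a \<rightharpoonup> 'b) \<Rightarrow> ('a \<Rightarrow> 'b) set" where
  "isopartial_elem X Y \<pi> = {f \<in> bijections X Y. \<forall>x\<in>dom \<pi>. \<pi> x = Some (f x)}"

text \<open>The endpoints of the \<open>i\<close>-th edge of the first graph are listed as \<open>a1 i, a2 i\<close>, those of
  the \<open>j\<close>-th edge of the second graph as \<open>b1 j, b2 j\<close>. Only the entries with indices in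
  \<open>{1..n}\<close> are meaningful.\<close>

definition canonical_transformation ::
    "'a set \<Rightarrow> 'b set \<Rightarrow> (nat \<Rightarrow> 'a) \<Rightarrow> (nat \<Rightarrow> 'a) \<Rightarrow> (nat \<Rightarrow> 'b) \<Rightarrow> (nat \<Rightarrow> 'b)
      \<Rightarrow> nat \<Rightarrow> nat \<Rightarrow> ('a \<Rightarrow> 'b) set" where
  "canonical_transformation X Y a1 a2 b1 b2 i j =
     isopartial_elem X Y [a1 i \<mapsto> b1 j, a2 i \<mapsto> b2 j]
       \<oplus>\<^bsub>isopartial_ring X Y\<^esub> isopartial_elem X Y [a1 i \<mapsto> b2 j, a2 i \<mapsto> b1 j]"

text \<open>No signs are needed in the determinant, since \<open>1 = -1\<close> in the ring of isopartials.\<close>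

definition isopartial_det ::
    "'a set \<Rightarrow> 'b set \<Rightarrow> nat \<Rightarrow> (nat \<Rightarrow> nat \<Rightarrow> ('a \<Rightarrow> 'b) set) \<Rightarrow> ('a \<Rightarrow> 'b) set" where
  "isopartial_det X Y n c =
     (\<Oplus>\<^bsub>isopartial_ring X Y\<^esub>\<rho>\<in>{\<rho>. \<rho> permutes {1..n}}.
        \<Otimes>\<^bsub>isopartial_ring X Y\<^esub>i\<in>{1..n}. c i (\<rho> i))"

lemma isopartial_pair:
  assumes "x1 \<in> X" "x2 \<in> X" "x1 \<noteq> x2" "y1 \<in> Y" "y2 \<in> Y" "y1 \<noteq> y2"
  shows "[x1 \<mapsto> y1, x2 \<mapsto> y2] \<in> isopartials X Y"
  using assms by (auto simp: isopartials_def ran_def inj_on_def)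

text \<open>The following fact ensures that \<open>finsum\<close> and \<open>finprod\<close> in the determinant have their
  intended meaning.\<close>

lemma cring_isopartial_ring: "cring (isopartial_ring X Y)"
proof (rule cringI)
  show "abelian_group (isopartial_ring X Y)"
  proof (rule abelian_groupI)
    fix P assume "P \<in> carrier (isopartial_ring X Y)"
    then show "\<exists>Q\<in>carrier (isopartial_ring X Y).
        Q \<oplus>\<^bsub>isopartial_ring X Y\<^esub> P = \<zero>\<^bsub>isopartial_ring X Y\<^esub>"
      by (intro bexI[of _ P]) (auto simp: isopartial_ring_def)
  qed (auto simp: isopartial_ring_def)
  show "comm_monoid (isopartial_ring X Y)"
    by (rule comm_monoidI) (auto simp: isopartial_ring_def)
qed (auto simp: isopartial_ring_def)

end

theory Submission
  imports Defs
begin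

text \<open>Read an element of the ring of isopartials as a set of bijections. The two isopartials in
  the entry \<open>(i, j)\<close> of the canonical transformation are the two ways of matching the endpoints of
  \<open>A i\<close> with those of \<open>B j\<close>; as \<open>B j\<close> has two distinct endpoints, no bijection extends both, so
  the entry is the set of bijections that carry \<open>A i\<close> onto \<open>B j\<close>
  (\<open>canonical_transformation_eq\<close>). The product belonging to a permutation \<open>\<rho>\<close> is then the set of
  bijections that carry each \<open>A i\<close> onto \<open>B (\<rho> i)\<close>.

  A bijection carries \<open>A i\<close> onto at most one of the edges \<open>B j\<close>, so products for different
  permutations are disjoint, their symmetric differences are unions, and nothing cancels in the
  determinant (\<open>isopartial_det_row_disjoint\<close>). Hence the determinant consists of the bijections
  that induce some matching \<open>\<rho>\<close> between the two lists of edges. These are exactly the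
  isomorphisms: an isomorphism is injective on edges because it is injective on vertices, so it
  permutes the edge indices (\<open>image_eq_iff_ex_permutation\<close>).\<close>

lemma finprod_isopartial_ring:
  assumes "finite I" and "\<And>i. i \<in> I \<Longrightarrow> g i \<subseteq> bijections X Y"
  shows "(\<Otimes>\<^bsub>isopartial_ring X Y\<^esub>i\<in>I. g i) = {f \<in> bijections X Y. \<forall>i\<in>I. f \<in> g i}"
proof -
  interpret cring "isopartial_ring X Y"
    by (rule cring_isopartial_ring)
  show ?thesis
    using assms
  proof (induction I rule: finite_induct)
    case empty
    show ?case
      unfolding finprod_empty
      by (simp add: isopartial_ring_def)
  next
    case (insert k I)
    have "g \<in> I \<rightarrow> carrier (isopartial_ring X Y)" "g k \<in> carrier (isopartial_ring X Y)"
      using insert.prems by (auto simp: isopartial_ring_def)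
    with insert have "(\<Otimes>\<^bsub>isopartial_ring X Y\<^esub>i\<in>insert k I. g i) =
        g k \<otimes>\<^bsub>isopartial_ring X Y\<^esub> {f \<in> bijections X Y. \<forall>i\<in>I. f \<in> g i}"
      by simp
    then show ?case
      using insert.prems by (auto simp: isopartial_ring_def)
  qed
qed

lemma finsum_isopartial_ring_disjoint:
  assumes "finite I" and "\<And>i. i \<in> I \<Longrightarrow> g i \<subseteq> bijections X Y"
    and "\<And>i j. i \<in> I \<Longrightarrow> j \<in> I \<Longrightarrow> i \<noteq> j \<Longrightarrow> g i \<inter> g j = {}"
  shows "(\<Oplus>\<^bsub>isopartial_ring X Y\<^esub>i\<in>I. g i) = (\<Union>i\<in>I. g i)"
proof -
  interpret cring "isopartial_ring X Y"
    by (rule cring_isopartial_ring)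
  show ?thesis
    using assms
  proof (induction I rule: finite_induct)
    case empty
    show ?case
      unfolding finsum_empty
      by (simp add: isopartial_ring_def)
  next
    case (insert k I)
    have "g \<in> I \<rightarrow> carrier (isopartial_ring X Y)" "g k \<in> carrier (isopartial_ring X Y)"
      using insert.prems(1) by (auto simp: isopartial_ring_def)
    moreover have "(\<Oplus>\<^bsub>isopartial_ring X Y\<^esub>i\<in>I. g i) = (\<Union>i\<in>I. g i)"
      using insert.prems by (intro insert.IH) auto
    ultimately have "(\<Oplus>\<^bsub>isopartial_ring X Y\<^esub>i\<in>insert k I. g i) =
        g k \<oplus>\<^bsub>isopartial_ring X Y\<^esub> (\<Union>i\<in>I. g i)"
      using insert.hyps by simp
    moreover have "g k \<inter> (\<Union>i\<in>I. g i) = {}"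
      using insert.prems(2)[of k] insert.hyps(2) by blast
    ultimately show ?case
      by (auto simp: isopartial_ring_def)
  qed
qed

text \<open>Two different permutations differ at some index \<open>i\<close> of \<open>{1..n}\<close>. Their products then contain
  different entries of row \<open>i\<close> as factors, so disjoint entries in each row make the products
  disjoint, and the sum over all permutations is a union.\<close>

lemma isopartial_det_row_disjoint:
  assumes sub: "\<And>i j. i \<in> {1..n} \<Longrightarrow> j \<in> {1..n} \<Longrightarrow> c i j \<subseteq> bijections X Y"
    and disj: "\<And>i j k. i \<in> {1..n} \<Longrightarrow> j \<in> {1..n} \<Longrightarrow> k \<in> {1..n} \<Longrightarrow> j \<noteq> k
      \<Longrightarrow> c i j \<inter> c i k = {}"
  shows "isopartial_det X Y n c =
    {f \<in> bijections X Y. \<exists>\<rho>. \<rho> permutes {1..n} \<and> (\<forall>i\<in>{1..n}. f \<in> c i (\<rho> i))}"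
proof -
  define P where "P \<rho> = (\<Otimes>\<^bsub>isopartial_ring X Y\<^esub>i\<in>{1..n}. c i (\<rho> i))" for \<rho>
  have P: "P \<rho> = {f \<in> bijections X Y. \<forall>i\<in>{1..n}. f \<in> c i (\<rho> i)}" if "\<rho> permutes {1..n}" for \<rho>
    unfolding P_def using sub permutes_in_image[OF that]
    by (intro finprod_isopartial_ring) blast+
  have disjP: "P \<rho> \<inter> P \<sigma> = {}"
    if \<rho>: "\<rho> permutes {1..n}" and \<sigma>: "\<sigma> permutes {1..n}" and "\<rho> \<noteq> \<sigma>" for \<rho> \<sigma>
  proof -
    obtain i where "\<rho> i \<noteq> \<sigma> i"
      using \<open>\<rho> \<noteq> \<sigma>\<close> by blast
    moreover from this have i: "i \<in> {1..n}"
      using \<rho> \<sigma> by (metis permutes_not_in)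
    moreover have "\<rho> i \<in> {1..n}" "\<sigma> i \<in> {1..n}"
      using i permutes_in_image[OF \<rho>] permutes_in_image[OF \<sigma>] by blast+
    ultimately have "c i (\<rho> i) \<inter> c i (\<sigma> i) = {}"
      by (intro disj)
    with i show ?thesis
      unfolding P[OF \<rho>] P[OF \<sigma>] by blast
  qed
  have "isopartial_det X Y n c = (\<Union>\<rho>\<in>{\<rho>. \<rho> permutes {1..n}}. P \<rho>)"
    unfolding isopartial_det_def P_def[symmetric]
    by (intro finsum_isopartial_ring_disjoint)
      (simp_all add: finite_permutations disjP, auto simp: P)
  also have "\<dots> = {f \<in> bijections X Y. \<exists>\<rho>. \<rho> permutes {1..n} \<and> (\<forall>i\<in>{1..n}. f \<in> c i (\<rho> i))}"
    by (auto simp: P)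
  finally show ?thesis .
qed

lemma isopartial_elem_pair:
  assumes "x1 \<noteq> x2"
  shows "isopartial_elem X Y [x1 \<mapsto> y1, x2 \<mapsto> y2] =
    {f \<in> bijections X Y. f x1 = y1 \<and> f x2 = y2}"
  unfolding isopartial_elem_def using assms by force

text \<open>If the endpoints \<open>b1 j\<close> and \<open>b2 j\<close> coincided, the two isopartials would be equal and cancel
  to the empty set.\<close>

lemma canonical_transformation_eq:
  fixes a1 a2 :: "nat \<Rightarrow> 'a" and b1 b2 :: "nat \<Rightarrow> 'b"
  assumes "a1 i \<noteq> a2 i" and "b1 j \<noteq> b2 j"
  shows "canonical_transformation X Y a1 a2 b1 b2 i j =
    {f \<in> bijections X Y. f ` {a1 i, a2 i} = {b1 j, b2 j}}"
proof -
  have "f ` {a1 i, a2 i} = {b1 j, b2 j} \<longleftrightarrow>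
      f (a1 i) = b1 j \<and> f (a2 i) = b2 j \<or> f (a1 i) = b2 j \<and> f (a2 i) = b1 j" for f :: "'a \<Rightarrow> 'b"
    by (simp add: doubleton_eq_iff)
  then show ?thesis
    using assms(2)
    by (simp only: canonical_transformation_def isopartial_elem_pair[OF assms(1)]
        isopartial_ring_def ring_record_simps) force
qed

text \<open>With \<open>F\<close> the map induced on edges, this translates equality of edge sets, which ignores the
  numbering, into a permutation of the indices.\<close>

lemma image_eq_iff_ex_permutation:
  assumes A: "bij_betw A I S" and B: "bij_betw B I T" and F: "inj_on F S"
  shows "F ` S = T \<longleftrightarrow> (\<exists>\<rho>. \<rho> permutes I \<and> (\<forall>i\<in>I. F (A i) = B (\<rho> i)))"
proof
  assume "F ` S = T"
  with F have "bij_betw F S T"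
    by (simp add: bij_betw_def)
  \<comment> \<open>Outside \<open>I\<close> the inverse of \<open>B\<close> after \<open>F\<close> after \<open>A\<close> can take any value, whereas a permutation
    of \<open>I\<close> has to be the identity there.\<close>
  define \<rho> where "\<rho> i = (if i \<in> I then inv_into I B (F (A i)) else i)" for i
  have "bij_betw (inv_into I B \<circ> (F \<circ> A)) I I"
    using A \<open>bij_betw F S T\<close> bij_betw_inv_into[OF B] by (blast intro: bij_betw_trans)
  then have "bij_betw \<rho> I I"
    by (rule bij_betw_cong[THEN iffD1, rotated]) (simp add: \<rho>_def)
  then have "\<rho> permutes I"
    by (rule bij_imp_permutes) (simp add: \<rho>_def)
  moreover have "F (A i) = B (\<rho> i)" if "i \<in> I" for i
    using that A \<open>F ` S = T\<close> bij_betw_inv_into_right[OF B]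
    by (auto simp: \<rho>_def bij_betw_def)
  ultimately show "\<exists>\<rho>. \<rho> permutes I \<and> (\<forall>i\<in>I. F (A i) = B (\<rho> i))"
    by blast
next
  assume "\<exists>\<rho>. \<rho> permutes I \<and> (\<forall>i\<in>I. F (A i) = B (\<rho> i))"
  then obtain \<rho> where \<rho>: "\<rho> permutes I" and eq: "\<forall>i\<in>I. F (A i) = B (\<rho> i)"
    by blast
  have "F ` S = (\<lambda>i. F (A i)) ` I"
    using A by (auto simp: bij_betw_def)
  also have "\<dots> = (\<lambda>i. B (\<rho> i)) ` I"
    using eq by (auto intro: image_cong)
  also have "\<dots> = B ` (\<rho> ` I)"
    by (simp add: image_image)
  also have "\<dots> = T"
    using B permutes_image[OF \<rho>] by (simp add: bij_betw_def)
  finally show "F ` S = T" .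
qed

theorem theorem6p2:
  fixes X :: "'a set" and Y :: "'b set" and m n :: nat
    and \<Gamma>1 :: "'a set set" and \<Gamma>2 :: "'b set set"
    and A :: "nat \<Rightarrow> 'a set" and B :: "nat \<Rightarrow> 'b set"
    and a1 a2 :: "nat \<Rightarrow> 'a" and b1 b2 :: "nat \<Rightarrow> 'b"
  assumes "finite X" and "finite Y" and "card X = m" and "card Y = m"
    and "graph_on X \<Gamma>1" and "graph_on Y \<Gamma>2"
    and "bij_betw A {1..n} \<Gamma>1" and "bij_betw B {1..n} \<Gamma>2"
    and "\<And>i. i \<in> {1..n} \<Longrightarrow> A i = {a1 i, a2 i}"
    and "\<And>j. j \<in> {1..n} \<Longrightarrow> B j = {b1 j, b2 j}"
  shows "graph_isos X Y \<Gamma>1 \<Gamma>2 =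
    isopartial_det X Y n (canonical_transformation X Y a1 a2 b1 b2)"
proof -
  let ?M = "canonical_transformation X Y a1 a2 b1 b2"
  have neq_a: "a1 i \<noteq> a2 i" if "i \<in> {1..n}" for i
    using that assms(5,7,9) by (force simp: graph_on_def bij_betw_def)
  have neq_b: "b1 j \<noteq> b2 j" if "j \<in> {1..n}" for j
    using that assms(6,8,10) by (force simp: graph_on_def bij_betw_def)
  have M: "?M i j = {f \<in> bijections X Y. f ` A i = B j}" if "i \<in> {1..n}" "j \<in> {1..n}" for i j
    unfolding assms(9)[OF that(1)] assms(10)[OF that(2)]
    by (intro canonical_transformation_eq neq_a neq_b that)
  have B_eq_iff: "B j = B k \<longleftrightarrow> j = k" if "j \<in> {1..n}" "k \<in> {1..n}" for j k
    using assms(8) that by (auto simp only: bij_betw_def inj_on_eq_iff)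
  have det: "isopartial_det X Y n ?M =
      {f \<in> bijections X Y. \<exists>\<rho>. \<rho> permutes {1..n} \<and> (\<forall>i\<in>{1..n}. f \<in> ?M i (\<rho> i))}"
  proof (rule isopartial_det_row_disjoint)
    show "?M i j \<subseteq> bijections X Y" if "i \<in> {1..n}" "j \<in> {1..n}" for i j
      unfolding M[OF that] by blast
    show "?M i j \<inter> ?M i k = {}"
      if "i \<in> {1..n}" "j \<in> {1..n}" "k \<in> {1..n}" "j \<noteq> k" for i j k
    proof -
      have "B j \<noteq> B k"
        using B_eq_iff that by blast
      then show ?thesis
        unfolding M[OF that(1,2)] M[OF that(1,3)] by blast
    qed
  qed
  have "(\<lambda>e. f ` e) ` \<Gamma>1 = \<Gamma>2 \<longleftrightarrow>
      (\<exists>\<rho>. \<rho> permutes {1..n} \<and> (\<forall>i\<in>{1..n}. f \<in> ?M i (\<rho> i)))"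
    if f: "f \<in> bijections X Y" for f
  proof -
    have "inj_on f X"
      using f by (auto simp: bijections_def bij_betw_def)
    moreover have "\<Gamma>1 \<subseteq> Pow X"
      using assms(5) by (auto simp: graph_on_def)
    ultimately have "inj_on (\<lambda>e. f ` e) \<Gamma>1"
      by (meson inj_on_image_Pow inj_on_subset)
    then have "(\<lambda>e. f ` e) ` \<Gamma>1 = \<Gamma>2 \<longleftrightarrow>
        (\<exists>\<rho>. \<rho> permutes {1..n} \<and> (\<forall>i\<in>{1..n}. f ` A i = B (\<rho> i)))"
      by (rule image_eq_iff_ex_permutation[OF assms(7,8)])
    also have "\<dots> \<longleftrightarrow> (\<exists>\<rho>. \<rho> permutes {1..n} \<and> (\<forall>i\<in>{1..n}. f \<in> ?M i (\<rho> i)))"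
    proof -
      have "f ` A i = B (\<rho> i) \<longleftrightarrow> f \<in> ?M i (\<rho> i)" if "\<rho> permutes {1..n}" "i \<in> {1..n}" for \<rho> i
      proof -
        have "\<rho> i \<in> {1..n}"
          using that permutes_in_image by metis
        then show ?thesis
          using f M[OF that(2)] by simp
      qed
      then show ?thesis
        by blast
    qed
    finally show ?thesis .
  qed
  then show ?thesis
    unfolding det graph_isos_def by blast
qed

end
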